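(* Let $\{X_i: 1\le i\le n\}$ be a finite family of $T_0$ spaces. Then the following two conditions are equivalent: (1) The product space $\prod_{i=1}^{n}X_i$ is a well-filtered determined space. (2) For each $1\le i\le n$, $X_i$ is a well-filtered determined space.
   Context: For a $T_0$ space $Z$, the specialization order is $x\le y$ iff $x\in\overline{\{y\}}$, and $\mathsf{K}(Z)$ is the set of nonempty compact saturated subsets (saturated = upper set in the specialization order). A family $\mathcal K\subseteq \mathsf K(Z)$ is filtered if it is nonempty and for all $K_1,K_2\in\mathcal K$ there is $K_3\in\mathcal K$ with $K_3\subseteq K_1\cap K_2$. $Z$ is well-filtered if it is $T_0$ and for every open $U\subseteq Z$ and every filtered family $\mathcal K\subseteq\mathsf K(Z)$, $\bigcap\mathcal K\subseteq U$ implies $K\subseteq U$ for some $K\in\mathcal K$. A nonempty subset $A$ of a space is irreducible if whenever $A\subseteq F_1\cup F_2$ with $F_1,F_2$ closed, then $A\subseteq F_1$ or $A\subseteq F_2$. A subset $A$ of a $T_0$ space $X$ is well-filtered determined if for every continuous map $h:X\to Z$ to a well-filtered space $Z$ there is a unique $z_A\in Z$ with $\overline{h(A)}=\overline{\{z_A\}}$. A $T_0$ space $X$ is well-filtered determined if every irreducible closed subset of $X$ is well-filtered determined.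
   Formalization: The spaces X_i are assumed nonempty; if some factor is empty, the product is empty and vacuously well-filtered determined, so (1) would not imply (2) (e.g. when another factor is an uncountable set with the cocountable topology). *)

theory Defs
  imports "HOL-Analysis.Analysis"
begin

definition specialization_le :: "'a topology \<Rightarrow> 'a \<Rightarrow> 'a \<Rightarrow> bool"
  where "specialization_le X x y \<longleftrightarrow>
    x \<in> topspace X \<and> y \<in> topspace X \<and> x \<in> X closure_of {y}"

definition saturated_in :: "'a topology \<Rightarrow> 'a set \<Rightarrow> bool"
  where "saturated_in X S \<longleftrightarrow>
    S \<subseteq> topspace X \<and> (\<forall>x\<in>S. \<forall>y. specialization_le X x y \<longrightarrow> y \<in> S)"

definition compact_saturated_sets :: "'a topology \<Rightarrow> 'a set set"
  where "compact_saturated_sets X = {K. K \<noteq> {} \<and> compactin X K \<and> saturated_in X K}"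

definition filtered_family :: "'a set set \<Rightarrow> bool"
  where "filtered_family \<K> \<longleftrightarrow>
    \<K> \<noteq> {} \<and> (\<forall>K1\<in>\<K>. \<forall>K2\<in>\<K>. \<exists>K3\<in>\<K>. K3 \<subseteq> K1 \<inter> K2)"

definition well_filtered_space :: "'a topology \<Rightarrow> bool"
  where "well_filtered_space Z \<longleftrightarrow>
    t0_space Z \<and>
    (\<forall>U \<K>. openin Z U \<and> \<K> \<subseteq> compact_saturated_sets Z \<and> filtered_family \<K> \<and> \<Inter>\<K> \<subseteq> U
       \<longrightarrow> (\<exists>K\<in>\<K>. K \<subseteq> U))"

definition irreducible_in :: "'a topology \<Rightarrow> 'a set \<Rightarrow> bool"
  where "irreducible_in X A \<longleftrightarrow>
    A \<subseteq> topspace X \<and> A \<noteq> {} \<and>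
    (\<forall>F1 F2. closedin X F1 \<and> closedin X F2 \<and> A \<subseteq> F1 \<union> F2 \<longrightarrow> A \<subseteq> F1 \<or> A \<subseteq> F2)"

text \<open>
  A definition cannot quantify over all types, so the test spaces \<open>Z\<close> below live on the type
  \<open>'a set\<close>.  This is no restriction: lemma \<open>wf_determined_in_any_type\<close> at the end of this theory
  shows that the defining property then holds for well-filtered test spaces on an arbitrary type.
\<close>

definition wf_determined_in :: "'a topology \<Rightarrow> 'a set \<Rightarrow> bool"
  where "wf_determined_in X A \<longleftrightarrow>
    A \<subseteq> topspace X \<and>
    (\<forall>(Z :: 'a set topology) h. well_filtered_space Z \<and> continuous_map X Z h
       \<longrightarrow> (\<exists>!z. z \<in> topspace Z \<and> Z closure_of (h ` A) = Z closure_of {z}))"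

definition wf_determined_space :: "'a topology \<Rightarrow> bool"
  where "wf_determined_space X \<longleftrightarrow>
    t0_space X \<and>
    (\<forall>A. closedin X A \<and> irreducible_in X A \<longrightarrow> wf_determined_in X A)"


subsection \<open>Independence of the type of the test spaces\<close>

text \<open>
  Given \<open>h\<close> from \<open>X\<close> to a well-filtered \<open>Z\<close> on any type, let \<open>Y\<close> be the set of those irreducible
  closed \<open>B\<close> for which the closure of \<open>h ` B\<close> is a point closure.  With the lower Vietoris topology,
  \<open>Y\<close> is well-filtered by a Rudin-type argument, and testing against it yields the claim for \<open>h\<close>.
\<close>

definition lower_vietoris :: "'a topology \<Rightarrow> 'a set set \<Rightarrow> 'a set topology"
  where "lower_vietoris X Y = topology (\<lambda>S. \<exists>U. openin X U \<and> S = {B\<in>Y. B \<inter> U \<noteq> {}})"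

lemma openin_lower_vietoris:
  assumes irr: "\<And>B. B \<in> Y \<Longrightarrow> irreducible_in X B"
  shows "openin (lower_vietoris X Y) S \<longleftrightarrow> (\<exists>U. openin X U \<and> S = {B\<in>Y. B \<inter> U \<noteq> {}})"
proof -
  let ?P = "\<lambda>S. \<exists>U. openin X U \<and> S = {B\<in>Y. B \<inter> U \<noteq> {}}"
  have "istopology ?P"
    unfolding istopology_def
  proof (intro conjI allI impI)
    fix S T assume "?P S" "?P T"
    then obtain U V where U: "openin X U" "S = {B\<in>Y. B \<inter> U \<noteq> {}}"
      and V: "openin X V" "T = {B\<in>Y. B \<inter> V \<noteq> {}}" by blast
    have "B \<inter> (U \<inter> V) \<noteq> {}" if B: "B \<in> Y" "B \<inter> U \<noteq> {}" "B \<inter> V \<noteq> {}" for B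
    proof
      assume e: "B \<inter> (U \<inter> V) = {}"
      have i: "irreducible_in X B" using irr B by blast
      have "B \<subseteq> (topspace X - U) \<union> (topspace X - V)"
        using e i unfolding irreducible_in_def by blast
      then have "B \<subseteq> topspace X - U \<or> B \<subseteq> topspace X - V"
        using i U(1) V(1) unfolding irreducible_in_def by blast
      then show False using B by blast
    qed
    then have "S \<inter> T = {B\<in>Y. B \<inter> (U \<inter> V) \<noteq> {}}" using U V by blast
    then show "?P (S \<inter> T)" using U V by blast
  next
    fix \<S> assume "\<forall>S\<in>\<S>. ?P S"
    then obtain u where u: "\<And>S. S \<in> \<S> \<Longrightarrow> openin X (u S) \<and> S = {B\<in>Y. B \<inter> u S \<noteq> {}}"
      by metis
    have "openin X (\<Union>(u ` \<S>))" using u by blast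
    moreover have "\<Union>\<S> = {B\<in>Y. B \<inter> \<Union>(u ` \<S>) \<noteq> {}}"
    proof (rule set_eqI)
      fix B
      have "B \<in> \<Union>\<S> \<longleftrightarrow> (\<exists>S\<in>\<S>. B \<in> Y \<and> B \<inter> u S \<noteq> {})"
        using u by blast
      then show "B \<in> \<Union>\<S> \<longleftrightarrow> B \<in> {B\<in>Y. B \<inter> \<Union>(u ` \<S>) \<noteq> {}}" by blast
    qed
    ultimately show "?P (\<Union>\<S>)" by blast
  qed
  then show ?thesis by (simp add: lower_vietoris_def)
qed

lemma topspace_lower_vietoris:
  assumes irr: "\<And>B. B \<in> Y \<Longrightarrow> irreducible_in X B"
  shows "topspace (lower_vietoris X Y) = Y"
proof
  show "topspace (lower_vietoris X Y) \<subseteq> Y"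
    using openin_lower_vietoris[OF irr] openin_topspace[of "lower_vietoris X Y"] by blast
  have "Y = {B\<in>Y. B \<inter> topspace X \<noteq> {}}" using irr unfolding irreducible_in_def by blast
  then have "openin (lower_vietoris X Y) Y" using openin_lower_vietoris[OF irr] by blast
  then show "Y \<subseteq> topspace (lower_vietoris X Y)" by (rule openin_subset)
qed

lemma closedin_lower_vietoris:
  assumes irr: "\<And>B. B \<in> Y \<Longrightarrow> irreducible_in X B" and "closedin X C"
  shows "closedin (lower_vietoris X Y) {B\<in>Y. B \<subseteq> C}"
proof -
  have "Y - {B\<in>Y. B \<subseteq> C} = {B\<in>Y. B \<inter> (topspace X - C) \<noteq> {}}"
    using irr unfolding irreducible_in_def by blast
  then show ?thesis
    using assms openin_lower_vietoris[OF irr]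
    by (auto simp: closedin_def topspace_lower_vietoris[OF irr])
qed

lemma compact_saturation:
  assumes "compactin Z S" "S \<noteq> {}"
  shows "{z. \<exists>s\<in>S. specialization_le Z s z} \<in> compact_saturated_sets Z" (is "?L \<in> _")
proof -
  have S: "S \<subseteq> topspace Z" using assms by (simp add: compactin_def)
  have up: "z \<in> U" if "openin Z U" "s \<in> U" "specialization_le Z s z" for s z U
    using that unfolding specialization_le_def in_closure_of by blast
  have sub: "S \<subseteq> ?L" using S by (auto simp: specialization_le_def in_closure_of)
  have "compactin Z ?L"
    unfolding compactin_def
  proof (intro conjI allI impI)
    show "?L \<subseteq> topspace Z" by (auto simp: specialization_le_def)
    fix \<U> assume U: "(\<forall>U\<in>\<U>. openin Z U) \<and> ?L \<subseteq> \<Union>\<U>"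
    then have "S \<subseteq> \<Union>\<U>" using sub by blast
    then obtain \<F> where F: "finite \<F>" "\<F> \<subseteq> \<U>" "S \<subseteq> \<Union>\<F>"
      using U assms(1) unfolding compactin_def by meson
    have "?L \<subseteq> \<Union>\<F>"
    proof
      fix z assume "z \<in> ?L"
      then obtain s where s: "s \<in> S" "specialization_le Z s z" by blast
      then obtain V where "V \<in> \<F>" "s \<in> V" using F by blast
      then show "z \<in> \<Union>\<F>" using up s U F by blast
    qed
    then show "\<exists>\<F>. finite \<F> \<and> \<F> \<subseteq> \<U> \<and> ?L \<subseteq> \<Union>\<F>" using F by blast
  qed
  moreover have "saturated_in Z ?L"
  proof -
    have "specialization_le Z s y" if "specialization_le Z s z" "specialization_le Z z y" for s z y
      using that unfolding specialization_le_def in_closure_of by blast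
    then show ?thesis
      unfolding saturated_in_def by (auto simp: specialization_le_def)
  qed
  moreover have "?L \<noteq> {}" using sub assms by blast
  ultimately show ?thesis by (simp add: compact_saturated_sets_def)
qed

lemma closure_of_image_closure:
  assumes "continuous_map X Z h" and A: "A \<subseteq> topspace X"
  shows "Z closure_of (h ` (X closure_of A)) = Z closure_of (h ` A)"
proof
  show "Z closure_of (h ` (X closure_of A)) \<subseteq> Z closure_of (h ` A)"
    using continuous_map_image_closure_subset[OF assms(1), of A]
    by (simp add: closure_of_minimal)
  show "Z closure_of (h ` A) \<subseteq> Z closure_of (h ` (X closure_of A))"
    using closure_of_subset[OF A] by (intro closure_of_mono image_mono)
qed

lemma irreducible_closure_sing:
  assumes "x \<in> topspace X"
  shows "irreducible_in X (X closure_of {x})"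
proof -
  have x: "x \<in> X closure_of {x}" using assms by (simp add: in_closure_of)
  have "X closure_of {x} \<subseteq> F" if "closedin X F" "x \<in> F" for F
    using that by (simp add: closure_of_minimal)
  then have "X closure_of {x} \<subseteq> F1 \<or> X closure_of {x} \<subseteq> F2"
    if "closedin X F1" "closedin X F2" "X closure_of {x} \<subseteq> F1 \<union> F2" for F1 F2
    using that x by blast
  then show ?thesis
    using x closure_of_subset_topspace[of X "{x}"] unfolding irreducible_in_def by blast
qed

lemma well_filtered_lower_vietoris:
  fixes X :: "'a topology" and Z :: "'z topology"
  assumes wf: "well_filtered_space Z" and h: "continuous_map X Z h"
  defines "Y \<equiv> {B. closedin X B \<and> irreducible_in X B \<and>
                   (\<exists>z\<in>topspace Z. Z closure_of (h ` B) = Z closure_of {z})}"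
  shows "well_filtered_space (lower_vietoris X Y)"
proof -
  define L where "L = lower_vietoris X Y"
  have irr: "\<And>B. B \<in> Y \<Longrightarrow> irreducible_in X B"
    and clo: "\<And>B. B \<in> Y \<Longrightarrow> closedin X B" by (auto simp: Y_def)
  have opn: "openin L S \<longleftrightarrow> (\<exists>U. openin X U \<and> S = {B\<in>Y. B \<inter> U \<noteq> {}})" for S
    using openin_lower_vietoris[OF irr] by (simp add: L_def)
  have top: "topspace L = Y" using topspace_lower_vietoris[OF irr] by (simp add: L_def)
  have hX: "h x \<in> topspace Z" if "x \<in> topspace X" for x
    using that h by (meson continuous_map_image_subset_topspace image_subset_iff)
  have t0: "t0_space L"
    unfolding t0_space
  proof (intro ballI impI)
    fix A B assume A: "A \<in> topspace L" and B: "B \<in> topspace L" and "A \<noteq> B"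
    have "closedin L {D\<in>Y. D \<subseteq> A}" "closedin L {D\<in>Y. D \<subseteq> B}"
      using closedin_lower_vietoris[OF irr] A B clo by (auto simp: L_def top[unfolded L_def])
    moreover have "B \<notin> {D\<in>Y. D \<subseteq> A} \<or> A \<notin> {D\<in>Y. D \<subseteq> B}" using \<open>A \<noteq> B\<close> by blast
    ultimately show "\<exists>C. closedin L C \<and> (A \<notin> C \<longleftrightarrow> B \<in> C)"
      using A B top by blast
  qed
  have "\<forall>B\<in>Y. \<exists>z. z \<in> topspace Z \<and> Z closure_of (h ` B) = Z closure_of {z}"
    unfolding Y_def by blast
  then obtain k where k: "\<And>B. B \<in> Y \<Longrightarrow> k B \<in> topspace Z \<and> Z closure_of (h ` B) = Z closure_of {k B}"
    by metis
  have kmeet: "k B \<in> V \<longleftrightarrow> (\<exists>x\<in>B. h x \<in> V)" if B: "B \<in> Y" and V: "openin Z V" for B V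
  proof -
    have "h ` B \<subseteq> topspace Z" using irr[OF B] hX unfolding irreducible_in_def by blast
    then have "V \<inter> h ` B = {} \<longleftrightarrow> V \<inter> Z closure_of (h ` B) = {}"
      by (simp add: V openin_Int_closure_of_eq_empty)
    also have "\<dots> \<longleftrightarrow> V \<inter> {k B} = {}"
      using k[OF B] V by (simp add: openin_Int_closure_of_eq_empty)
    finally show ?thesis by blast
  qed
  have kcont: "continuous_map L Z k"
    unfolding continuous_map_def
  proof (intro conjI allI impI)
    show "k \<in> topspace L \<rightarrow> topspace Z" using k top by blast
    fix V assume V: "openin Z V"
    define U where "U = {x \<in> topspace X. h x \<in> V}"
    have "openin X U" using h V unfolding U_def by (simp add: openin_continuous_map_preimage)
    moreover have "{B \<in> topspace L. k B \<in> V} = {B\<in>Y. B \<inter> U \<noteq> {}}"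
      using kmeet[OF _ V] irr unfolding top U_def irreducible_in_def by blast
    ultimately show "openin L {B \<in> topspace L. k B \<in> V}" using opn by blast
  qed
  have "\<exists>K\<in>\<K>. K \<subseteq> W"
    if W: "openin L W" and KK: "\<K> \<subseteq> compact_saturated_sets L" and fil: "filtered_family \<K>"
      and Int: "\<Inter>\<K> \<subseteq> W" for W \<K>
  proof (rule ccontr)
    assume no: "\<not> (\<exists>K\<in>\<K>. K \<subseteq> W)"
    obtain U where U: "openin X U" and W': "W = {B\<in>Y. B \<inter> U \<noteq> {}}" using W opn by blast
    have KY: "K \<subseteq> Y" and Kc: "compactin L K" and Ks: "saturated_in L K" if "K \<in> \<K>" for K
      using KK that top unfolding compact_saturated_sets_def saturated_in_def by auto
    define \<O> where "\<O> = {G. openin X G \<and> U \<subseteq> G \<and> (\<forall>K\<in>\<K>. \<exists>B\<in>K. B \<inter> G = {})}"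
    have "U \<in> \<O>" using U no W' KY unfolding \<O>_def by blast
    have "\<exists>M\<in>\<O>. \<forall>G\<in>\<O>. M \<subseteq> G \<longrightarrow> G = M"
    proof (rule subset_Zorn_nonempty)
      show "\<O> \<noteq> {}" using \<open>U \<in> \<O>\<close> by blast
      fix C assume C: "C \<noteq> {}" "subset.chain \<O> C"
      then have CO: "C \<subseteq> \<O>" by (simp add: subset.chain_def)
      have "\<exists>B\<in>K. B \<inter> \<Union>C = {}" if K: "K \<in> \<K>" for K
      proof (rule ccontr)
        assume n: "\<not> (\<exists>B\<in>K. B \<inter> \<Union>C = {})"
        let ?d = "\<lambda>G. {B\<in>Y. B \<inter> G \<noteq> {}}"
        have cov: "K \<subseteq> \<Union>(?d ` C)"
        proof
          fix B assume B: "B \<in> K"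
          then have "B \<inter> \<Union>C \<noteq> {}" using n by simp
          then obtain G where "G \<in> C" "B \<inter> G \<noteq> {}" by auto
          then show "B \<in> \<Union>(?d ` C)" using B KY[OF K] by auto
        qed
        have opnd: "openin L S" if "S \<in> ?d ` C" for S
        proof -
          from that obtain G where G: "S = ?d G" "G \<in> C" by (rule imageE)
          then have "openin X G" using CO unfolding \<O>_def by auto
          then show ?thesis using opn G by blast
        qed
        have "\<exists>\<F>. finite \<F> \<and> \<F> \<subseteq> ?d ` C \<and> K \<subseteq> \<Union>\<F>"
          by (rule compactinD[OF Kc[OF K] opnd cov])
        then obtain \<F> where F: "finite \<F>" "\<F> \<subseteq> ?d ` C" "K \<subseteq> \<Union>\<F>"
          by (elim exE conjE)
        obtain D where D: "D \<subseteq> C" "finite D" "\<F> = ?d ` D"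
          using finite_subset_image[OF F(1,2)] by blast
        obtain O1 where "O1 \<in> C" using C by blast
        then have D': "finite (insert O1 D)" "insert O1 D \<noteq> {}" "insert O1 D \<subseteq> C"
          using D by auto
        have "subset.chain \<O> (insert O1 D)"
          using C(2) D'(3) unfolding subset_chain_def by (meson subset_trans subsetD)
        then have "\<Union>(insert O1 D) \<in> insert O1 D" by (rule Union_in_chain[OF D'(1,2)])
        then have "\<Union>(insert O1 D) \<in> C" using D'(3) by (rule subsetD[rotated])
        then obtain O2 where O2: "O2 \<in> C" "\<Union>D \<subseteq> O2" by auto
        have "O2 \<in> \<O>" using CO O2(1) by (rule subsetD)
        then obtain B where "B \<in> K" "B \<inter> O2 = {}" using K unfolding \<O>_def by auto
        moreover have "B \<inter> \<Union>D \<noteq> {}"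
        proof -
          obtain S where "S \<in> \<F>" "B \<in> S" using \<open>B \<in> K\<close> F(3) by auto
          then show ?thesis using D(3) by auto
        qed
        ultimately show False using O2 by blast
      qed
      moreover have "openin X (\<Union>C)" using CO unfolding \<O>_def by blast
      moreover have "U \<subseteq> \<Union>C" using CO C(1) unfolding \<O>_def by blast
      ultimately show "\<Union>C \<in> \<O>" unfolding \<O>_def by blast
    qed
    then obtain M where M: "M \<in> \<O>" and Mmax: "\<And>G. G \<in> \<O> \<Longrightarrow> M \<subseteq> G \<Longrightarrow> G = M" by blast
    define C where "C = topspace X - M"
    have cC: "closedin X C" using M unfolding C_def \<O>_def by blast
    have CU: "C \<inter> U = {}" using M unfolding C_def \<O>_def by blast
    have Ctop: "C \<subseteq> topspace X" unfolding C_def by blast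
    have meet: "\<exists>B\<in>K. B \<subseteq> C" if K: "K \<in> \<K>" for K
    proof -
      obtain B where "B \<in> K" "B \<inter> M = {}" using M K unfolding \<O>_def by auto
      moreover have "B \<subseteq> topspace X"
        using irr[of B] KY[OF K] \<open>B \<in> K\<close> unfolding irreducible_in_def by blast
      ultimately show ?thesis unfolding C_def by blast
    qed
    have min: "C \<subseteq> F" if F: "closedin X F" and m: "\<And>K. K \<in> \<K> \<Longrightarrow> \<exists>B\<in>K. B \<subseteq> C \<inter> F" for F
    proof -
      define O' where "O' = M \<union> (topspace X - F)"
      have "openin X O'" using M F unfolding O'_def \<O>_def by blast
      moreover have "\<exists>B\<in>K. B \<inter> O' = {}" if "K \<in> \<K>" for K
        using m[OF that] unfolding C_def O'_def by blast
      moreover have "U \<subseteq> O'" using M unfolding O'_def \<O>_def by blast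
      ultimately have "O' = M" using Mmax[of O'] unfolding \<O>_def O'_def by blast
      then show ?thesis unfolding C_def O'_def by blast
    qed
    obtain K0 where K0: "K0 \<in> \<K>" using fil unfolding filtered_family_def by blast
    have Cirr: "irreducible_in X C"
      unfolding irreducible_in_def
    proof (intro conjI allI impI)
      show "C \<subseteq> topspace X" by (rule Ctop)
      show "C \<noteq> {}" using meet[OF K0] KY[OF K0] irr unfolding irreducible_in_def by blast
      fix F1 F2 assume F: "closedin X F1 \<and> closedin X F2 \<and> C \<subseteq> F1 \<union> F2"
      show "C \<subseteq> F1 \<or> C \<subseteq> F2"
      proof (rule ccontr)
        assume "\<not> (C \<subseteq> F1 \<or> C \<subseteq> F2)"
        then have n1: "\<not> C \<subseteq> F1" and n2: "\<not> C \<subseteq> F2" by auto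
        obtain K1 where K1: "K1 \<in> \<K>" "\<not> (\<exists>B\<in>K1. B \<subseteq> C \<inter> F1)"
          using min[of F1] F n1 by metis
        obtain K2 where K2: "K2 \<in> \<K>" "\<not> (\<exists>B\<in>K2. B \<subseteq> C \<inter> F2)"
          using min[of F2] F n2 by metis
        obtain K3 where K3: "K3 \<in> \<K>" "K3 \<subseteq> K1 \<inter> K2"
          using fil K1 K2 unfolding filtered_family_def by blast
        obtain B where B: "B \<in> K3" "B \<subseteq> C" using meet[OF K3(1)] by blast
        have "irreducible_in X B" using irr KY[OF K3(1)] B(1) by blast
        moreover have "B \<subseteq> F1 \<union> F2" using B F by blast
        ultimately have "B \<subseteq> F1 \<or> B \<subseteq> F2" using F by (simp add: irreducible_in_def)
        then have "B \<subseteq> C \<inter> F1 \<or> B \<subseteq> C \<inter> F2" using B(2) by auto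
        moreover have "B \<in> K1" "B \<in> K2" using B(1) K3(2) by auto
        ultimately show False using K1(2) K2(2) by auto
      qed
    qed
    define P where "P K = k ` (K \<inter> {B\<in>Y. B \<subseteq> C})" for K
    define Q where "Q K = {z. \<exists>s\<in>P K. specialization_le Z s z}" for K
    have Q: "Q K \<in> compact_saturated_sets Z" if K: "K \<in> \<K>" for K
    proof -
      have "closedin L {B\<in>Y. B \<subseteq> C}"
        using closedin_lower_vietoris[OF irr cC] by (simp add: L_def)
      then have "compactin L (K \<inter> {B\<in>Y. B \<subseteq> C})"
        using Kc[OF K] by (metis Int_commute closed_Int_compactin)
      then have "compactin Z (P K)" using kcont image_compactin unfolding P_def by blast
      moreover have "P K \<noteq> {}" using meet[OF K] KY[OF K] unfolding P_def by blast
      ultimately show ?thesis using compact_saturation unfolding Q_def by blast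
    qed
    define E where "E = Z closure_of (h ` C)"
    have hC: "h ` C \<subseteq> topspace Z" using Ctop hX by blast
    have "filtered_family (Q ` \<K>)"
      unfolding filtered_family_def
    proof (intro conjI ballI)
      show "Q ` \<K> \<noteq> {}" using K0 by blast
      fix S T assume "S \<in> Q ` \<K>" "T \<in> Q ` \<K>"
      then obtain K1 K2 where K12: "K1 \<in> \<K>" "S = Q K1" "K2 \<in> \<K>" "T = Q K2" by blast
      obtain K3 where K3: "K3 \<in> \<K>" "K3 \<subseteq> K1 \<inter> K2"
        using fil K12 unfolding filtered_family_def by blast
      have "Q K3 \<subseteq> S \<inter> T" using K3 K12 unfolding Q_def P_def by blast
      then show "\<exists>R\<in>Q ` \<K>. R \<subseteq> S \<inter> T" using K3 by blast
    qed
    moreover have "Q ` \<K> \<subseteq> compact_saturated_sets Z" using Q by blast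
    moreover have "openin Z (topspace Z - E)" unfolding E_def by (simp add: openin_diff)
    moreover have "\<not> (\<exists>R\<in>Q ` \<K>. R \<subseteq> topspace Z - E)"
    proof -
      have "\<not> Q K \<subseteq> topspace Z - E" if K: "K \<in> \<K>" for K
      proof -
        obtain B where B: "B \<in> K" "B \<subseteq> C" using meet K by blast
        then have BY: "B \<in> Y" using KY K by blast
        have kt: "k B \<in> topspace Z" using k BY by blast
        have kk: "k B \<in> Z closure_of {k B}" using kt by (simp add: in_closure_of)
        have "k B \<in> Z closure_of (h ` B)" using k[OF BY] kk by blast
        also have "\<dots> \<subseteq> E" unfolding E_def using B by (intro closure_of_mono image_mono)
        finally have "k B \<in> E" .
        moreover have "k B \<in> Q K"
          using kk kt B BY unfolding Q_def P_def specialization_le_def by blast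
        ultimately show ?thesis by blast
      qed
      then show ?thesis by blast
    qed
    ultimately have "\<not> \<Inter>(Q ` \<K>) \<subseteq> topspace Z - E"
      using wf unfolding well_filtered_space_def by meson
    then obtain z where zQ: "\<And>K. K \<in> \<K> \<Longrightarrow> z \<in> Q K" and znot: "z \<notin> topspace Z - E" by blast
    have zt: "z \<in> topspace Z" using zQ[OF K0] unfolding Q_def specialization_le_def by blast
    then have zE: "z \<in> E" using znot by blast
    define F where "F = {x \<in> topspace X. h x \<in> Z closure_of {z}}"
    have "closedin X F"
      unfolding F_def using h by (simp add: closedin_continuous_map_preimage)
    moreover have "\<exists>B\<in>K. B \<subseteq> C \<inter> F" if K: "K \<in> \<K>" for K
    proof -
      obtain B where B: "B \<in> K" "B \<in> Y" "B \<subseteq> C" and s: "specialization_le Z (k B) z"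
        using zQ[OF K] unfolding Q_def P_def by blast
      have "Z closure_of (h ` B) \<subseteq> Z closure_of {z}"
        using k[OF B(2)] s by (simp add: specialization_le_def closure_of_minimal)
      moreover have "h ` B \<subseteq> Z closure_of (h ` B)"
        using B hC by (intro closure_of_subset) blast
      ultimately have "B \<subseteq> F" using B Ctop unfolding F_def by blast
      then show ?thesis using B by blast
    qed
    ultimately have "C \<subseteq> F" by (rule min)
    then have "E \<subseteq> Z closure_of {z}"
      unfolding E_def F_def by (intro closure_of_minimal) auto
    moreover have "Z closure_of {z} \<subseteq> E"
      using zE unfolding E_def by (simp add: closure_of_minimal)
    ultimately have "E = Z closure_of {z}" by blast
    then have CY: "C \<in> Y" using cC Cirr zt unfolding Y_def E_def by blast
    have "C \<in> K" if K: "K \<in> \<K>" for K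
    proof -
      obtain B where B: "B \<in> K" "B \<subseteq> C" using meet K by blast
      have "B \<in> Y" using B KY K by blast
      then have "specialization_le L B C"
        using CY B(2) unfolding specialization_le_def in_closure_of top opn by blast
      then show ?thesis using Ks[OF K] B unfolding saturated_in_def by blast
    qed
    then have "C \<in> W" using Int by blast
    then show False using W' CU by blast
  qed
  then show ?thesis
    using t0 unfolding well_filtered_space_def L_def[symmetric] by blast
qed

lemma wf_determined_in_any_type:
  fixes X :: "'a topology" and Z :: "'z topology"
  assumes wd: "wf_determined_in X A" and wf: "well_filtered_space Z" and h: "continuous_map X Z h"
  shows "\<exists>!z. z \<in> topspace Z \<and> Z closure_of (h ` A) = Z closure_of {z}"
proof -
  define Y where "Y = {B. closedin X B \<and> irreducible_in X B \<and>
                   (\<exists>z\<in>topspace Z. Z closure_of (h ` B) = Z closure_of {z})}"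
  define L where "L = lower_vietoris X Y"
  define e where "e x = X closure_of {x}" for x
  have irr: "\<And>B. B \<in> Y \<Longrightarrow> irreducible_in X B"
    and clo: "\<And>B. B \<in> Y \<Longrightarrow> closedin X B" by (auto simp: Y_def)
  have opn: "openin L S \<longleftrightarrow> (\<exists>U. openin X U \<and> S = {B\<in>Y. B \<inter> U \<noteq> {}})" for S
    using openin_lower_vietoris[OF irr] by (simp add: L_def)
  have top: "topspace L = Y" using topspace_lower_vietoris[OF irr] by (simp add: L_def)
  have wfL: "well_filtered_space L"
    unfolding L_def Y_def by (rule well_filtered_lower_vietoris[OF wf h])
  have AX: "A \<subseteq> topspace X" using wd by (simp add: wf_determined_in_def)
  have hX: "h x \<in> topspace Z" if "x \<in> topspace X" for x
    using that h by (meson continuous_map_image_subset_topspace image_subset_iff)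
  have eY: "e x \<in> Y" if x: "x \<in> topspace X" for x
    using closure_of_image_closure[OF h, of "{x}"] x hX[OF x] irreducible_closure_sing[OF x]
    unfolding Y_def e_def by auto
  have xe: "x \<in> e x" if "x \<in> topspace X" for x using that by (simp add: e_def in_closure_of)
  have emeet: "e x \<inter> U \<noteq> {} \<longleftrightarrow> x \<in> U" if "x \<in> topspace X" "openin X U" for x U
    using openin_Int_closure_of_eq_empty[OF that(2), of "{x}"] unfolding e_def by blast
  have "continuous_map X L e"
    unfolding continuous_map_def
  proof (intro conjI allI impI)
    show "e \<in> topspace X \<rightarrow> topspace L" using eY top by blast
    fix S assume "openin L S"
    then obtain U where U: "openin X U" "S = {B\<in>Y. B \<inter> U \<noteq> {}}" using opn by blast
    have "{x \<in> topspace X. e x \<in> S} = U"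
      using U emeet eY openin_subset[OF U(1)] by blast
    then show "openin X {x \<in> topspace X. e x \<in> S}" using U by simp
  qed
  then obtain B where BL: "B \<in> topspace L" and B: "L closure_of (e ` A) = L closure_of {B}"
    using wd wfL unfolding wf_determined_in_def by meson
  have BY: "B \<in> Y" using BL top by blast
  have "closedin L {D\<in>Y. D \<subseteq> B}"
    using closedin_lower_vietoris[OF irr clo[OF BY]] by (simp add: L_def)
  then have "L closure_of {B} \<subseteq> {D\<in>Y. D \<subseteq> B}" using BY by (simp add: closure_of_minimal)
  moreover have "e ` A \<subseteq> L closure_of (e ` A)"
    using AX eY top by (intro closure_of_subset) blast
  ultimately have AB: "A \<subseteq> B" using B xe AX by blast
  have "closedin L {D\<in>Y. D \<subseteq> X closure_of A}"
    using closedin_lower_vietoris[OF irr closedin_closure_of] by (simp add: L_def)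
  moreover have "e ` A \<subseteq> {D\<in>Y. D \<subseteq> X closure_of A}"
    using eY AX unfolding e_def by (auto intro: closure_of_mono[THEN subsetD, of "{_}"])
  ultimately have "L closure_of (e ` A) \<subseteq> {D\<in>Y. D \<subseteq> X closure_of A}" by (simp add: closure_of_minimal)
  moreover have "B \<in> L closure_of {B}" using BL by (simp add: in_closure_of)
  ultimately have "B \<subseteq> X closure_of A" using B by blast
  then have "B = X closure_of A" using closure_of_minimal[OF AB clo[OF BY]] by blast
  then have "Z closure_of (h ` A) = Z closure_of (h ` B)"
    using closure_of_image_closure[OF h AX] by simp
  then obtain z where z: "z \<in> topspace Z" "Z closure_of (h ` A) = Z closure_of {z}"
    using BY unfolding Y_def by auto
  moreover have "t0_space Z" using wf by (simp add: well_filtered_space_def)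
  ultimately show ?thesis by (metis t0_space_closure_of_sing)
qed

end

theory Submission
  imports Defs
begin

text \<open>
  An irreducible closed subset of a product is the product of its projections, because an
  irreducible set meeting finitely many open sets meets their intersection.  A product
  \<open>A \<times> B\<close> of well-filtered determined sets is well-filtered determined: for
  \<open>f\<close> on \<open>X \<times> Y\<close>, the map sending \<open>x\<close> to the generic point of the closure
  of \<open>f ` ({x} \<times> B)\<close> is continuous, and its image of \<open>A\<close> has the same closure as
  \<open>f ` (A \<times> B)\<close>.  Conversely, each factor is a retract of the product.
\<close>

section \<open>Irreducible sets\<close>

lemma irreducible_in_image:
  assumes A: "irreducible_in X A" and f: "continuous_map X Y f"
  shows "irreducible_in Y (f ` A)"
  unfolding irreducible_in_def
proof (intro conjI allI impI)
  have AX: "A \<subseteq> topspace X" and ne: "A \<noteq> {}"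
    using A by (auto simp: irreducible_in_def)
  show "f ` A \<subseteq> topspace Y"
    using AX continuous_map_image_subset_topspace[OF f] by blast
  show "f ` A \<noteq> {}" using ne by simp
  fix F1 F2 assume F: "closedin Y F1 \<and> closedin Y F2 \<and> f ` A \<subseteq> F1 \<union> F2"
  let ?P = "\<lambda>F. {x \<in> topspace X. f x \<in> F}"
  have "closedin X (?P F1)" "closedin X (?P F2)"
    using F f by (auto intro: closedin_continuous_map_preimage)
  moreover have "A \<subseteq> ?P F1 \<union> ?P F2" using AX F by blast
  ultimately have "A \<subseteq> ?P F1 \<or> A \<subseteq> ?P F2"
    using A unfolding irreducible_in_def by meson
  then show "f ` A \<subseteq> F1 \<or> f ` A \<subseteq> F2" by blast
qed

lemma irreducible_in_closure_of:
  assumes A: "irreducible_in X A"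
  shows "irreducible_in X (X closure_of A)"
proof -
  have sub: "A \<subseteq> X closure_of A"
    using A by (simp add: irreducible_in_def closure_of_subset)
  have "X closure_of A \<subseteq> F1 \<or> X closure_of A \<subseteq> F2"
    if F: "closedin X F1" "closedin X F2" "X closure_of A \<subseteq> F1 \<union> F2" for F1 F2
  proof -
    have "A \<subseteq> F1 \<or> A \<subseteq> F2"
      using A F sub unfolding irreducible_in_def by (meson subset_trans)
    then show ?thesis using F by (meson closure_of_minimal)
  qed
  moreover have "X closure_of A \<noteq> {}"
    using A sub by (auto simp: irreducible_in_def)
  ultimately show ?thesis
    by (simp add: irreducible_in_def closure_of_subset_topspace)
qed

lemma irreducible_in_meets_Int:
  assumes A: "irreducible_in X A" and "openin X U" "openin X V" "A \<inter> U \<noteq> {}" "A \<inter> V \<noteq> {}"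
  shows "A \<inter> (U \<inter> V) \<noteq> {}"
proof
  assume "A \<inter> (U \<inter> V) = {}"
  then have "A \<subseteq> (topspace X - U) \<union> (topspace X - V)"
    using A unfolding irreducible_in_def by blast
  then have "A \<subseteq> topspace X - U \<or> A \<subseteq> topspace X - V"
    using A assms(2,3) unfolding irreducible_in_def by blast
  then show False using assms(4,5) by blast
qed

lemma irreducible_in_meets_finite_INT:
  assumes A: "irreducible_in X A" and "finite I"
    and "\<And>i. i \<in> I \<Longrightarrow> openin X (V i) \<and> A \<inter> V i \<noteq> {}"
  shows "A \<inter> (topspace X \<inter> (\<Inter>i\<in>I. V i)) \<noteq> {}"
proof -
  \<comment> \<open>Openness is carried through the induction because the binary case asks for it.
    The factor \<open>topspace X\<close> keeps the intersection open when \<open>I\<close> is empty,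
    where the bare one is \<open>UNIV\<close>.\<close>
  have "openin X (topspace X \<inter> (\<Inter>i\<in>I. V i)) \<and> A \<inter> (topspace X \<inter> (\<Inter>i\<in>I. V i)) \<noteq> {}"
    using assms(2,3)
  proof (induction I rule: finite_induct)
    case empty
    then show ?case using A by (auto simp: irreducible_in_def)
  next
    case (insert k I)
    have *: "topspace X \<inter> (\<Inter>i\<in>insert k I. V i) = V k \<inter> (topspace X \<inter> (\<Inter>i\<in>I. V i))"
      by blast
    show ?case
      unfolding * using insert irreducible_in_meets_Int[OF A]
      by (simp add: openin_Int)
  qed
  then show ?thesis by blast
qed

text \<open>For the nontrivial inclusion, every basic box around a point \<open>g\<close> of the
  right-hand side contains a point of \<open>B\<close>, so \<open>g\<close> lies in the closure of
  \<open>B\<close>, which is \<open>B\<close>.\<close>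

lemma irreducible_closed_eq_PiE:
  assumes fin: "finite I" and cl: "closedin (product_topology X I) B"
    and irr: "irreducible_in (product_topology X I) B"
  shows "B = PiE I (\<lambda>i. (\<lambda>f. f i) ` B)"
proof
  have BX: "B \<subseteq> PiE I (\<lambda>i. topspace (X i))"
    using irr by (simp add: irreducible_in_def)
  then show "B \<subseteq> PiE I (\<lambda>i. (\<lambda>f. f i) ` B)" by (auto simp: PiE_iff)
  show "PiE I (\<lambda>i. (\<lambda>f. f i) ` B) \<subseteq> B"
  proof
    fix g assume g: "g \<in> PiE I (\<lambda>i. (\<lambda>f. f i) ` B)"
    have gt: "g \<in> topspace (product_topology X I)"
      using g BX by (fastforce simp: PiE_iff)
    have "\<exists>f\<in>B. f \<in> T" if T: "g \<in> T" "openin (product_topology X I) T" for T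
    proof -
      obtain U where U: "\<forall>i\<in>I. openin (X i) (U i)" "g \<in> PiE I U" "PiE I U \<subseteq> T"
        using T by (auto simp: openin_product_topology_alt)
      define V where "V i = {f \<in> topspace (product_topology X I). f i \<in> U i}" for i
      have "openin (product_topology X I) (V i) \<and> B \<inter> V i \<noteq> {}" if i: "i \<in> I" for i
      proof
        show "openin (product_topology X I) (V i)"
          unfolding V_def using U(1) i
          by (intro openin_continuous_map_preimage[OF continuous_map_product_projection]) auto
        \<comment> \<open>This \<open>f\<close> depends on \<open>i\<close>; irreducibility then
          replaces these points by a single member of \<open>B\<close> that lies in all the
          \<open>V i\<close>.\<close>
        obtain f where "f \<in> B" "g i = f i" using g i by (auto simp: PiE_iff)
        moreover have "g i \<in> U i" using U(2) i by (auto simp: PiE_iff)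
        ultimately show "B \<inter> V i \<noteq> {}" using BX unfolding V_def by auto
      qed
      then obtain f where "f \<in> B" "\<forall>i\<in>I. f \<in> V i"
        using irreducible_in_meets_finite_INT[OF irr fin, of V] by blast
      then have "f \<in> PiE I U" using BX unfolding V_def by (auto simp: PiE_iff)
      then show ?thesis using \<open>f \<in> B\<close> U(3) by blast
    qed
    then have "g \<in> product_topology X I closure_of B"
      using gt unfolding in_closure_of by blast
    then show "g \<in> B" using cl by (simp add: closure_of_closedin)
  qed
qed


section \<open>Well-filtered determined sets\<close>

text \<open>Distinct points of a \<open>T0\<close> space have distinct closures, so existence of the
  generic point suffices.\<close>

lemma wf_determined_inI:
  fixes X :: "'a topology"
  assumes "A \<subseteq> topspace X"
    and ex: "\<And>(Z :: 'a set topology) h. well_filtered_space Z \<Longrightarrow> continuous_map X Z h \<Longrightarrow>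
      \<exists>z\<in>topspace Z. Z closure_of (h ` A) = Z closure_of {z}"
  shows "wf_determined_in X A"
  unfolding wf_determined_in_def
proof (intro conjI allI impI)
  fix Z :: "'a set topology" and h
  assume Z: "well_filtered_space Z \<and> continuous_map X Z h"
  then have "t0_space Z" by (simp add: well_filtered_space_def)
  moreover obtain z where "z \<in> topspace Z" "Z closure_of (h ` A) = Z closure_of {z}"
    using ex Z by blast
  ultimately show "\<exists>!z. z \<in> topspace Z \<and> Z closure_of (h ` A) = Z closure_of {z}"
    by (metis t0_space_closure_of_sing)
qed (fact assms(1))

lemma wf_determined_in_sing:
  fixes X :: "'a topology"
  assumes x: "x \<in> topspace X"
  shows "wf_determined_in X {x}"
proof (rule wf_determined_inI)
  show "{x} \<subseteq> topspace X" using x by simp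
  fix Z :: "'a set topology" and h
  assume "continuous_map X Z h"
  then have "h x \<in> topspace Z" using x continuous_map_image_subset_topspace by blast
  then show "\<exists>z\<in>topspace Z. Z closure_of (h ` {x}) = Z closure_of {z}"
    by (intro bexI[of _ "h x"]) simp_all
qed

text \<open>A test map \<open>h\<close> on \<open>Y\<close> becomes the test map
  \<open>h \<circ> f\<close> on \<open>X\<close>. Its target has type \<open>'b set\<close> rather
  than \<open>'a set\<close>, hence the appeal to \<open>wf_determined_in_any_type\<close>.\<close>

lemma wf_determined_in_image:
  assumes A: "wf_determined_in X A" and f: "continuous_map X Y f"
  shows "wf_determined_in Y (f ` A)"
proof (rule wf_determined_inI)
  have "A \<subseteq> topspace X" using A by (simp add: wf_determined_in_def)
  then show "f ` A \<subseteq> topspace Y"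
    using continuous_map_image_subset_topspace[OF f] by blast
  fix Z :: "'b set topology" and h
  assume Z: "well_filtered_space Z" and h: "continuous_map Y Z h"
  show "\<exists>z\<in>topspace Z. Z closure_of (h ` f ` A) = Z closure_of {z}"
    using wf_determined_in_any_type[OF A Z continuous_map_compose[OF f h]]
    unfolding image_comp by blast
qed

lemma wf_determined_in_of_closure:
  assumes "A \<subseteq> topspace X" and cl: "wf_determined_in X (X closure_of A)"
  shows "wf_determined_in X A"
proof (rule wf_determined_inI[OF assms(1)])
  fix Z :: "'a set topology" and h
  assume Z: "well_filtered_space Z" and h: "continuous_map X Z h"
  show "\<exists>z\<in>topspace Z. Z closure_of (h ` A) = Z closure_of {z}"
    using wf_determined_in_any_type[OF cl Z h] closure_of_image_closure[OF h assms(1)] by auto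
qed

text \<open>Extends the defining property from closed to arbitrary irreducible sets, as is required
  for projections, which need not be closed.\<close>

lemma wf_determined_in_irreducible:
  assumes "wf_determined_space X" "irreducible_in X A"
  shows "wf_determined_in X A"
proof (rule wf_determined_in_of_closure)
  show "A \<subseteq> topspace X" using assms(2) by (simp add: irreducible_in_def)
  show "wf_determined_in X (X closure_of A)"
    using assms irreducible_in_closure_of[of X A] closedin_closure_of[of X A]
    unfolding wf_determined_space_def by blast
qed

lemma wf_determined_in_Times:
  fixes X :: "'a topology" and Y :: "'b topology"
  assumes A: "wf_determined_in X A" and B: "wf_determined_in Y B"
  shows "wf_determined_in (prod_topology X Y) (A \<times> B)"
proof (rule wf_determined_inI)
  have AX: "A \<subseteq> topspace X" and BY: "B \<subseteq> topspace Y"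
    using A B by (simp_all add: wf_determined_in_def)
  then show "A \<times> B \<subseteq> topspace (prod_topology X Y)" by auto
  fix Z :: "('a \<times> 'b) set topology" and h
  assume Z: "well_filtered_space Z" and h: "continuous_map (prod_topology X Y) Z h"
  have row: "continuous_map Y Z (\<lambda>y. h (x, y))" if "x \<in> topspace X" for x
    using continuous_map_compose[OF _ h, of Y "\<lambda>y. (x, y)"] that
    by (simp add: o_def continuous_map_pairedI)
  have "\<exists>z. z \<in> topspace Z \<and> Z closure_of ((\<lambda>y. h (x, y)) ` B) = Z closure_of {z}"
    if "x \<in> topspace X" for x
    using wf_determined_in_any_type[OF B Z row[OF that]] by blast
  then obtain g where g: "\<And>x. x \<in> topspace X \<Longrightarrow>
      g x \<in> topspace Z \<and> Z closure_of ((\<lambda>y. h (x, y)) ` B) = Z closure_of {g x}"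
    by metis
  \<comment> \<open>An open set meets a set iff it meets its closure, so \<open>V\<close> cannot
    distinguish the generic point \<open>g x\<close> from the row it represents.\<close>
  have gV: "g x \<in> V \<longleftrightarrow> (\<exists>y\<in>B. h (x, y) \<in> V)" if x: "x \<in> topspace X" and V: "openin Z V" for x V
  proof -
    have "V \<inter> (\<lambda>y. h (x, y)) ` B = {} \<longleftrightarrow> V \<inter> Z closure_of ((\<lambda>y. h (x, y)) ` B) = {}"
      by (simp add: V openin_Int_closure_of_eq_empty)
    also have "\<dots> \<longleftrightarrow> V \<inter> {g x} = {}"
      using g[OF x] V by (simp add: openin_Int_closure_of_eq_empty)
    finally show ?thesis by blast
  qed
  have col: "continuous_map X Z (\<lambda>x. h (x, y))" if "y \<in> topspace Y" for y
    using continuous_map_compose[OF _ h, of X "\<lambda>x. (x, y)"] that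
    by (simp add: o_def continuous_map_pairedI)
  have gcont: "continuous_map X Z g"
    unfolding continuous_map_def
  proof (intro conjI allI impI)
    show "g \<in> topspace X \<rightarrow> topspace Z" using g by blast
    fix V assume V: "openin Z V"
    \<comment> \<open>The preimage under \<open>g\<close> is a union of preimages along the columns
      \<open>y \<in> B\<close>, each of them open.\<close>
    have "{x \<in> topspace X. g x \<in> V} = (\<Union>y\<in>B. {x \<in> topspace X. h (x, y) \<in> V})"
      using gV[OF _ V] by blast
    also have "openin X \<dots>"
    proof (intro openin_clauses(3) ballI)
      fix S assume "S \<in> (\<lambda>y. {x \<in> topspace X. h (x, y) \<in> V}) ` B"
      then obtain y where "y \<in> B" and S: "S = {x \<in> topspace X. h (x, y) \<in> V}" by blast
      then have "continuous_map X Z (\<lambda>x. h (x, y))" using col BY by blast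
      then show "openin X S" unfolding S using V by (rule openin_continuous_map_preimage)
    qed
    finally show "openin X {x \<in> topspace X. g x \<in> V}" .
  qed
  obtain z where z: "z \<in> topspace Z" "Z closure_of (g ` A) = Z closure_of {z}"
    using wf_determined_in_any_type[OF A Z gcont] by blast
  have "Z closure_of (h ` (A \<times> B)) = Z closure_of (g ` A)"
  proof -
    \<comment> \<open>A closure is determined by which open sets meet the set, so \<open>gV\<close>
      identifies the two closures.\<close>
    have *: "(\<exists>w. w \<in> h ` (A \<times> B) \<and> w \<in> V) \<longleftrightarrow> (\<exists>w. w \<in> g ` A \<and> w \<in> V)"
      if "openin Z V" for V
      using gV[OF _ that] AX by fastforce
    show ?thesis
      unfolding set_eq_iff in_closure_of by (simp only: * simp_thms cong: conj_cong imp_cong)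
  qed
  then show "\<exists>z\<in>topspace Z. Z closure_of (h ` (A \<times> B)) = Z closure_of {z}" using z by auto
qed

text \<open>Induction on the index set: updating coordinate \<open>k\<close> is a continuous map
  that carries the binary product onto the product over \<open>insert k I\<close>.\<close>

lemma wf_determined_in_PiE:
  assumes "finite I" and "\<And>i. i \<in> I \<Longrightarrow> wf_determined_in (X i) (A i)"
  shows "wf_determined_in (product_topology X I) (PiE I A)"
  using assms
proof (induction I rule: finite_induct)
  case empty
  \<comment> \<open>The empty product consists of the single function that is
    \<open>undefined\<close> everywhere.\<close>
  then show ?case by (simp add: wf_determined_in_sing)
next
  case (insert k I)
  let ?\<phi> = "\<lambda>(x, f). f(k := x)"
  have "continuous_map (prod_topology (X k) (product_topology X I))
          (product_topology X (insert k I)) ?\<phi>"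
    unfolding continuous_map_componentwise
  proof (intro conjI ballI)
    show "?\<phi> ` topspace (prod_topology (X k) (product_topology X I)) \<subseteq> extensional (insert k I)"
      by (auto simp: PiE_iff extensional_def)
    fix i assume i: "i \<in> insert k I"
    show "continuous_map (prod_topology (X k) (product_topology X I)) (X i) (\<lambda>p. ?\<phi> p i)"
    proof (cases "i = k")
      case True
      then show ?thesis by (simp add: case_prod_unfold continuous_map_fst)
    next
      case False
      then have "i \<in> I" using i by blast
      then show ?thesis
        using continuous_map_compose[OF continuous_map_snd continuous_map_product_projection, of i I]
          False by (simp add: case_prod_unfold o_def)
    qed
  qed
  moreover have "wf_determined_in (prod_topology (X k) (product_topology X I)) (A k \<times> PiE I A)"
    using insert by (intro wf_determined_in_Times) auto
  ultimately have "wf_determined_in (product_topology X (insert k I)) (?\<phi> ` (A k \<times> PiE I A))"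
    by (rule wf_determined_in_image[rotated])
  then show ?case by (simp add: PiE_insert_eq)
qed

section \<open>Passing from sets to spaces: products, retracts and factors\<close>

lemma wf_determined_space_product:
  assumes fin: "finite I" and wd: "\<And>i. i \<in> I \<Longrightarrow> wf_determined_space (X i)"
  shows "wf_determined_space (product_topology X I)"
  unfolding wf_determined_space_def
proof (intro conjI allI impI)
  show "t0_space (product_topology X I)"
    using wd unfolding t0_space_product_topology wf_determined_space_def by blast
  fix B assume B: "closedin (product_topology X I) B \<and> irreducible_in (product_topology X I) B"
  have "wf_determined_in (X i) ((\<lambda>f. f i) ` B)" if "i \<in> I" for i
    by (rule wf_determined_in_irreducible[OF wd[OF that]
          irreducible_in_image[OF conjunct2[OF B] continuous_map_product_projection[OF that]]])
  then have "wf_determined_in (product_topology X I) (PiE I (\<lambda>i. (\<lambda>f. f i) ` B))"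
    by (rule wf_determined_in_PiE[OF fin])
  then show "wf_determined_in (product_topology X I) B"
    using irreducible_closed_eq_PiE[OF fin conjunct1[OF B] conjunct2[OF B]] by simp
qed

text \<open>An irreducible closed \<open>A\<close> is sent by \<open>s\<close> to an irreducible set
  of \<open>Y\<close>, which is determined there; \<open>r\<close> carries this property back to
  \<open>r\<close> s \<open>A = A\<close>.\<close>

lemma wf_determined_space_retract:
  assumes wd: "wf_determined_space Y" and t0: "t0_space X"
    and s: "continuous_map X Y s" and r: "continuous_map Y X r"
    and rs: "\<And>x. x \<in> topspace X \<Longrightarrow> r (s x) = x"
  shows "wf_determined_space X"
  unfolding wf_determined_space_def
proof (intro conjI allI impI t0)
  fix A assume A: "closedin X A \<and> irreducible_in X A"
  then have "wf_determined_in X (r ` s ` A)"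
    using wf_determined_in_image[OF wf_determined_in_irreducible[OF wd irreducible_in_image[OF _ s]] r]
    by blast
  moreover have "r ` s ` A = A"
  proof -
    have "r (s x) = x" if "x \<in> A" for x using A rs that unfolding irreducible_in_def by blast
    then show ?thesis by (simp add: image_image)
  qed
  ultimately show "wf_determined_in X A" by simp
qed

lemma wf_determined_space_product_factor:
  assumes wd: "wf_determined_space (product_topology X I)" and k: "k \<in> I"
    and t0: "t0_space (X k)" and ne: "\<And>i. i \<in> I \<Longrightarrow> topspace (X i) \<noteq> {}"
  shows "wf_determined_space (X k)"
proof -
  have "\<forall>i\<in>I. \<exists>x. x \<in> topspace (X i)" using ne by blast
  then obtain c where c: "\<And>i. i \<in> I \<Longrightarrow> c i \<in> topspace (X i)"
    unfolding bchoice_iff by blast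
  \<comment> \<open>A section of the projection to coordinate \<open>k\<close>: all other
    coordinates are frozen at the base point \<open>c\<close>, and \<open>restrict\<close> makes the
    value extensional, as points of the product must be.\<close>
  define s where "s x = restrict (c(k := x)) I" for x
  have "continuous_map (X k) (X i) (\<lambda>x. s x i)" if "i \<in> I" for i
    using that c by (cases "i = k") (simp_all add: s_def)
  then have "continuous_map (X k) (product_topology X I) s"
    by (auto simp: continuous_map_componentwise s_def)
  then show ?thesis
    using wf_determined_space_retract[OF wd t0 _ continuous_map_product_projection[OF k]] k
    by (simp add: s_def)
qed

text \<open>Nonempty factors matter for the forward direction: an empty factor makes the product
  empty, hence vacuously well-filtered determined whatever the other factors are.\<close>

theorem theorem6p30:
  fixes n :: nat and X :: "nat \<Rightarrow> 'a topology"
  assumes "\<And>i. i \<in> {1..n} \<Longrightarrow> t0_space (X i)"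
    and "\<And>i. i \<in> {1..n} \<Longrightarrow> topspace (X i) \<noteq> {}"
  shows "wf_determined_space (product_topology X {1..n})
           \<longleftrightarrow> (\<forall>i\<in>{1..n}. wf_determined_space (X i))"
  using assms wf_determined_space_product[of "{1..n}" X]
    wf_determined_space_product_factor[of X "{1..n}"]
  by blast

end
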